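(* If $\mathbf{x}$ is an extreme point of the spectral scale $B$ of $c$, then $\mathbf{x}$ lies in an isotrace slice of the form $I_{k/n}$ for some $k\in\{0,1,\dots,n\}$.
   Context: Let $c$ be a linear operator on an $n$-dimensional complex Hilbert space $H$, let $B(H)$ be the algebra of all linear operators on $H$, and let $\tau$ be the normalized trace on $B(H)$ (so $\tau(1)=1$). Define $\Psi(a)=(\tau(a),\tau(ca))\in\mathbb{R}\times\mathbb{C}$ for self-adjoint $a\in B(H)$. The spectral scale of $c$ is $B=B(c)=\{\Psi(a): a\in B(H),\ 0\le a\le 1\}\subset\mathbb{R}\times\mathbb{C}$. For $0\le t\le 1$ the isotrace slice of $B$ at $t$ is $I_t=\{(x_0,z)\in B: x_0=t\}$. *)

theory Defs
  imports "HOL-Analysis.Analysis"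
begin

(* The inner product is linear in its first argument. Completeness is automatic in finite
   dimension, so it is not a separate axiom. *)
locale finite_dim_hilbert = vector_space scale
  for scale :: "complex \<Rightarrow> 'h::ab_group_add \<Rightarrow> 'h" +
  fixes ip :: "'h \<Rightarrow> 'h \<Rightarrow> complex"
  assumes finite_dim: "\<exists>B. finite B \<and> span B = UNIV"
    and ip_add: "ip (x + y) z = ip x z + ip y z"
    and ip_scale: "ip (scale r x) y = r * ip x y"
    and ip_commute: "ip y x = cnj (ip x y)"
    and ip_nonneg: "0 \<le> Re (ip x x)"
    and ip_eq_zero: "ip x x = 0 \<Longrightarrow> x = 0"
begin

definition operators :: "('h \<Rightarrow> 'h) set" where
  "operators = {a. Vector_Spaces.linear scale scale a}"

(* Sum of the diagonal matrix entries of a with respect to a basis B. *)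
definition trace_wrt :: "'h set \<Rightarrow> ('h \<Rightarrow> 'h) \<Rightarrow> complex" where
  "trace_wrt B a = (\<Sum>b\<in>B. representation B (a b) b)"

(* extend_basis {} is a basis of the whole space selected by the library; by
   trace_wrt_unique below the choice does not matter. *)
definition op_trace :: "('h \<Rightarrow> 'h) \<Rightarrow> complex" where
  "op_trace a = trace_wrt (extend_basis {}) a"

definition normalized_trace :: "('h \<Rightarrow> 'h) \<Rightarrow> complex" where
  "normalized_trace a = op_trace a / of_nat (dim UNIV)"

definition self_adjoint :: "('h \<Rightarrow> 'h) \<Rightarrow> bool" where
  "self_adjoint a \<longleftrightarrow> a \<in> operators \<and> (\<forall>x y. ip (a x) y = ip x (a y))"

definition op_le :: "('h \<Rightarrow> 'h) \<Rightarrow> ('h \<Rightarrow> 'h) \<Rightarrow> bool" where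
  "op_le a b \<longleftrightarrow> self_adjoint (\<lambda>x. b x - a x) \<and> (\<forall>x. 0 \<le> Re (ip (b x - a x) x))"

(* For self-adjoint a the trace is real, so Re only changes the type here. *)
definition Psi :: "('h \<Rightarrow> 'h) \<Rightarrow> ('h \<Rightarrow> 'h) \<Rightarrow> real \<times> complex" where
  "Psi c a = (Re (normalized_trace a), normalized_trace (c \<circ> a))"

definition spectral_scale :: "('h \<Rightarrow> 'h) \<Rightarrow> (real \<times> complex) set" where
  "spectral_scale c = {Psi c a |a. a \<in> operators \<and> op_le (\<lambda>x. 0) a \<and> op_le a (\<lambda>x. x)}"

definition isotrace_slice :: "('h \<Rightarrow> 'h) \<Rightarrow> real \<Rightarrow> (real \<times> complex) set" where
  "isotrace_slice c t = {(x0, z). (x0, z) \<in> spectral_scale c \<and> x0 = t}"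

lemma finite_basis:
  assumes "independent B" "span B = UNIV"
  shows "finite B"
proof -
  obtain C where "finite C" "span C = UNIV" using finite_dim by blast
  then show ?thesis using independent_span_bound[of C B] assms by auto
qed

lemma trace_wrt_unique:
  assumes a: "a \<in> operators"
    and B: "independent B" "span B = UNIV"
    and C: "independent C" "span C = UNIV"
  shows "trace_wrt B a = trace_wrt C a"
proof -
  interpret a: Vector_Spaces.linear scale scale a using a by (simp add: operators_def)
  have fB: "finite B" and fC: "finite C" using finite_basis B C by auto
  have expand: "representation D (f (\<Sum>e\<in>E. scale (r e) e)) d = (\<Sum>e\<in>E. r e * representation D (f e) d)"
    if "independent D" "span D = UNIV" "Vector_Spaces.linear scale scale f" "finite E" for D E f r d
  proof -
    interpret f: Vector_Spaces.linear scale scale f by fact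
    show ?thesis using that
      by (simp add: f.sum f.scale representation_sum representation_scale)
  qed
  have lid: "Vector_Spaces.linear scale scale (\<lambda>x. x)" by (rule linear_ident)
  have "trace_wrt B a = (\<Sum>b\<in>B. \<Sum>d\<in>C. representation C (a b) d * representation B d b)"
    unfolding trace_wrt_def
  proof (rule sum.cong[OF refl])
    fix b
    have "a b = (\<Sum>d\<in>C. scale (representation C (a b) d) d)"
      using sum_representation_eq[of C "a b" C] C fC by simp
    then show "representation B (a b) b = (\<Sum>d\<in>C. representation C (a b) d * representation B d b)"
      using expand[OF B lid fC, of "representation C (a b)" b] by simp
  qed
  also have "\<dots> = (\<Sum>d\<in>C. \<Sum>b\<in>B. representation B d b * representation C (a b) d)"
    by (subst sum.swap) (simp add: mult.commute)
  also have "\<dots> = trace_wrt C a"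
    unfolding trace_wrt_def
  proof (rule sum.cong[OF refl])
    fix d
    have "d = (\<Sum>b\<in>B. scale (representation B d b) b)"
      using sum_representation_eq[of B d B] B fB by simp
    then show "(\<Sum>b\<in>B. representation B d b * representation C (a b) d) = representation C (a d) d"
      using expand[OF C a.linear_axioms fB, of "representation B d" d] by simp
  qed
  finally show ?thesis .
qed

lemma extend_basis_empty: "independent (extend_basis {})" "span (extend_basis {}) = UNIV"
  using independent_extend_basis[OF independent_empty] span_extend_basis[OF independent_empty] by auto

lemma op_trace_eq:
  assumes "a \<in> operators" "independent B" "span B = UNIV"
  shows "op_trace a = trace_wrt B a"
  unfolding op_trace_def
  by (rule trace_wrt_unique) (use assms extend_basis_empty in simp_all)

lemma normalized_trace_id:
  assumes "0 < dim UNIV"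
  shows "normalized_trace (\<lambda>x. x) = 1"
proof -
  let ?B = "extend_basis {}"
  note B = extend_basis_empty
  have "op_trace (\<lambda>x. x) = of_nat (card ?B)"
    using B by (simp add: op_trace_def trace_wrt_def representation_basis)
  moreover have "card ?B = dim UNIV"
    using B by (metis dim_eq_card span_UNIV)
  ultimately show ?thesis using assms by (simp add: normalized_trace_def)
qed

end

end

theory Submission imports Defs begin

text \<open>
  An operator \<open>a\<close> with \<open>0 \<le> a \<le> 1\<close> is the midpoint of \<open>a\<^sup>2\<close> and \<open>2a - a\<^sup>2\<close>, and both of these again
  lie between \<open>0\<close> and \<open>1\<close>. Since \<open>\<Psi>\<close> is linear, \<open>\<Psi>(a)\<close> is the midpoint of two points of the
  spectral scale. If \<open>\<Psi>(a)\<close> is extreme, these two points coincide, and comparing their first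
  coordinates gives \<open>\<tau>(a - a\<^sup>2) = 0\<close>. As \<open>a - a\<^sup>2 \<ge> 0\<close> and the trace is faithful on positive
  operators, \<open>a = a\<^sup>2\<close>. So every operator representing an extreme point is a projection. The
  trace of an idempotent is its rank \<open>k\<close>, hence \<open>\<tau>(a) = k/n\<close>.

  The order facts rest on the identity \<open>a - a\<^sup>2 = a(1 - a)a + (1 - a)a(1 - a)\<close>, which exhibits
  \<open>a - a\<^sup>2\<close> as a sum of two positive operators.
\<close>

context finite_dim_hilbert
begin

section \<open>Operators between zero and the identity\<close>

text \<open>Such operators are called effects in quantum mechanics.\<close>
definition effect :: "('h \<Rightarrow> 'h) \<Rightarrow> bool" where
  "effect a \<longleftrightarrow> a \<in> operators \<and> op_le (\<lambda>x. 0) a \<and> op_le a (\<lambda>x. x)"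

lemma ip_add_right: "ip x (y + z) = ip x y + ip x z"
  by (metis ip_add ip_commute complex_cnj_add)

lemma ip_scale_right: "ip x (scale r y) = cnj r * ip x y"
  by (metis ip_scale ip_commute complex_cnj_mult)

lemma ip_diff: "ip (x - y) z = ip x z - ip y z"
  by (metis ip_add add_diff_cancel_right' diff_add_cancel)

lemma ip_diff_right: "ip x (y - z) = ip x y - ip x z"
  by (metis ip_add_right add_diff_cancel_right' diff_add_cancel)

lemma ip_zero [simp]: "ip 0 y = 0" "ip y 0 = 0"
  using ip_diff[of 0 0 y] ip_diff_right[of y 0 0] by auto

lemma ip_sum: "ip (\<Sum>i\<in>I. f i) z = (\<Sum>i\<in>I. ip (f i) z)"
  by (induction I rule: infinite_finite_induct) (simp_all add: ip_add)

lemma operators_add: "a \<in> operators \<Longrightarrow> a (x + y) = a x + a y"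
  unfolding operators_def by (simp add: Vector_Spaces.linear_iff)

lemma operators_scale: "a \<in> operators \<Longrightarrow> a (scale r x) = scale r (a x)"
  unfolding operators_def by (simp add: Vector_Spaces.linear_iff)

lemma operators_diff: "a \<in> operators \<Longrightarrow> a (x - y) = a x - a y"
  by (metis operators_add add_diff_cancel_right' diff_add_cancel)

lemma operatorsI:
  assumes "\<And>x y. a (x + y) = a x + a y" "\<And>r x. a (scale r x) = scale r (a x)"
  shows "a \<in> operators"
  using assms unfolding operators_def
  by (simp add: Vector_Spaces.linear_iff vector_space_axioms)

lemma effect_iff:
  "effect a \<longleftrightarrow> self_adjoint a
     \<and> (\<forall>x. 0 \<le> Re (ip (a x) x) \<and> Re (ip (a x) x) \<le> Re (ip x x))"
proof -
  have "self_adjoint (\<lambda>x. x - a x)" if a: "self_adjoint a"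
  proof -
    have "(\<lambda>x. x - a x) \<in> operators"
      using a by (intro operatorsI)
        (auto simp: self_adjoint_def operators_add operators_scale scale_right_diff_distrib)
    then show ?thesis
      using a by (auto simp: self_adjoint_def ip_diff ip_diff_right)
  qed
  then show ?thesis
    unfolding effect_def op_le_def by (auto simp: self_adjoint_def ip_diff)
qed

lemma effect_self_adjoint: "effect a \<Longrightarrow> self_adjoint a"
  by (simp add: effect_iff)

lemma self_adjoint_operator: "self_adjoint a \<Longrightarrow> a \<in> operators"
  by (simp add: self_adjoint_def)

lemma self_adjoint_ip: "self_adjoint a \<Longrightarrow> ip (a x) y = ip x (a y)"
  by (simp add: self_adjoint_def)

lemma self_adjoint_square:
  assumes "self_adjoint a"
  shows "self_adjoint (\<lambda>x. a (a x))"
  unfolding self_adjoint_def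
proof
  show "(\<lambda>x. a (a x)) \<in> operators"
    using self_adjoint_operator[OF assms]
    by (intro operatorsI) (auto simp: operators_add operators_scale)
  show "\<forall>x y. ip (a (a x)) y = ip x (a (a y))"
    using assms by (auto simp: self_adjoint_ip)
qed

lemma self_adjoint_add:
  assumes "self_adjoint a" "self_adjoint b"
  shows "self_adjoint (\<lambda>x. a x + b x)"
proof -
  have "(\<lambda>x. a x + b x) \<in> operators"
    using assms[THEN self_adjoint_operator]
    by (intro operatorsI) (auto simp: operators_add operators_scale scale_right_distrib)
  then show ?thesis
    using assms by (auto simp: self_adjoint_def ip_add ip_add_right)
qed

lemma self_adjoint_diff:
  assumes "self_adjoint a" "self_adjoint b"
  shows "self_adjoint (\<lambda>x. a x - b x)"
proof -
  have "(\<lambda>x. a x - b x) \<in> operators"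
    using assms[THEN self_adjoint_operator]
    by (intro operatorsI) (auto simp: operators_add operators_scale scale_right_diff_distrib)
  then show ?thesis
    using assms by (auto simp: self_adjoint_def ip_diff ip_diff_right)
qed

text \<open>Pair \<open>a - a\<^sup>2 = a(1 - a)a + (1 - a)a(1 - a)\<close> with \<open>x\<close>: the two summands are the forms of
  \<open>1 - a\<close> at \<open>a x\<close> and of \<open>a\<close> at \<open>x - a x\<close>.\<close>
lemma effect_square_le:
  assumes "effect a"
  shows "Re (ip (a (a x)) x) \<le> Re (ip (a x) x)"
proof -
  have sa: "self_adjoint a" and op: "a \<in> operators"
    using assms effect_self_adjoint self_adjoint_operator by auto
  have "ip (a x) x - ip (a (a x)) x
      = (ip (a x) (a x) - ip (a (a x)) (a x)) + ip (a (x - a x)) (x - a x)"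
    by (simp add: operators_diff[OF op] ip_diff ip_diff_right self_adjoint_ip[OF sa])
  moreover have "Re (ip (a (a x)) (a x)) \<le> Re (ip (a x) (a x))"
    and "0 \<le> Re (ip (a (x - a x)) (x - a x))"
    using assms by (auto simp: effect_iff)
  ultimately show ?thesis
    by (metis add_nonneg_nonneg diff_ge_0_iff_ge minus_complex.sel(1) plus_complex.sel(1))
qed

lemma effect_square:
  assumes "effect a"
  shows "effect (\<lambda>x. a (a x))"
proof -
  have sa: "self_adjoint a" using assms by (rule effect_self_adjoint)
  have "0 \<le> Re (ip (a (a x)) x)" for x
    using ip_nonneg[of "a x"] by (simp add: self_adjoint_ip[OF sa])
  moreover have "Re (ip (a (a x)) x) \<le> Re (ip x x)" for x
    using effect_square_le[OF assms, of x] assms effect_iff order_trans by blast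
  ultimately show ?thesis
    using self_adjoint_square[OF sa] by (simp add: effect_iff)
qed

lemma effect_reflected_square:
  assumes "effect a"
  shows "effect (\<lambda>x. a x + (a x - a (a x)))"
proof -
  have sa: "self_adjoint a" using assms by (rule effect_self_adjoint)
  have "0 \<le> Re (ip (a x + (a x - a (a x))) x)" for x
  proof -
    have "0 \<le> Re (ip (a x) x)" using assms by (simp add: effect_iff)
    then show ?thesis
      using effect_square_le[OF assms, of x] by (simp add: ip_add ip_diff)
  qed
  moreover have "Re (ip (a x + (a x - a (a x))) x) \<le> Re (ip x x)" for x
    \<comment> \<open>Here \<open>1 - (2a - a\<^sup>2) = (1 - a)\<^sup>2\<close>.\<close>
    using ip_nonneg[of "x - a x"]
    by (simp add: ip_add ip_diff ip_diff_right self_adjoint_ip[OF sa])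
  ultimately show ?thesis
    using self_adjoint_add[OF sa self_adjoint_diff[OF sa self_adjoint_square[OF sa]]]
    by (simp add: effect_iff)
qed

lemma effect_diff_square:
  assumes "effect a"
  shows "effect (\<lambda>x. a x - a (a x))"
proof -
  have sa: "self_adjoint a" using assms by (rule effect_self_adjoint)
  have "Re (ip (a x - a (a x)) x) \<le> Re (ip x x)" for x
  proof -
    have "Re (ip (a x) x) \<le> Re (ip x x)" "0 \<le> Re (ip (a (a x)) x)"
      using assms effect_square[OF assms] by (simp_all add: effect_iff)
    then show ?thesis by (simp add: ip_diff)
  qed
  moreover have "0 \<le> Re (ip (a x - a (a x)) x)" for x
    using effect_square_le[OF assms, of x] by (simp add: ip_diff)
  ultimately show ?thesis
    using self_adjoint_diff[OF sa self_adjoint_square[OF sa]] by (simp add: effect_iff)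
qed

text \<open>Since \<open>b\<^sup>2 \<le> b\<close>, the form of \<open>b\<close> at \<open>x\<close> bounds \<open>\<parallel>b x\<parallel>\<^sup>2\<close> from above.\<close>
lemma effect_form_zero:
  assumes "effect b" "Re (ip (b x) x) = 0"
  shows "b x = 0"
proof -
  have sa: "self_adjoint b" using assms(1) by (rule effect_self_adjoint)
  have "Re (ip (b x) (b x)) = 0"
    using effect_square_le[OF assms(1), of x] assms(2) ip_nonneg[of "b x"]
    by (simp add: self_adjoint_ip[OF sa])
  moreover have "Im (ip (b x) (b x)) = 0"
    using ip_commute[of "b x" "b x"] by (simp add: complex_eq_iff)
  ultimately show ?thesis
    using ip_eq_zero by (simp add: complex_eq_iff)
qed

section \<open>Orthonormal bases and faithfulness of the trace\<close>

definition orthonormal :: "'h set \<Rightarrow> bool" where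
  "orthonormal E \<longleftrightarrow> (\<forall>e\<in>E. \<forall>f\<in>E. ip e f = (if e = f then 1 else 0))"

lemma orthonormal_ip_sum:
  assumes "orthonormal E" "finite F" "F \<subseteq> E" "e \<in> E"
  shows "ip (\<Sum>f\<in>F. scale (r f) f) e = (if e \<in> F then r e else 0)"
proof -
  have "ip (\<Sum>f\<in>F. scale (r f) f) e = (\<Sum>f\<in>F. if f = e then r f else 0)"
    unfolding ip_sum ip_scale using assms by (intro sum.cong) (auto simp: orthonormal_def)
  then show ?thesis using assms by (simp add: if_distrib)
qed

lemma orthonormal_independent:
  assumes "orthonormal E"
  shows "independent E"
proof
  assume "dependent E"
  then obtain F r e where F: "finite F" "F \<subseteq> E" "(\<Sum>f\<in>F. scale (r f) f) = 0"
    and e: "e \<in> F" "r e \<noteq> 0"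
    unfolding dependent_explicit by blast
  then have "r e = 0"
    using orthonormal_ip_sum[OF assms F(1,2), of e r] by auto
  with e show False by simp
qed

text \<open>An orthonormal set of largest size spans: otherwise the component of an outside vector
  orthogonal to it could be normalized and added.\<close>
lemma orthonormal_basis_exists:
  obtains E where "orthonormal E" "independent E" "span E = UNIV"
proof -
  obtain C where C: "finite C" "span C = UNIV" using finite_dim by blast
  have bound: "finite E \<and> card E \<le> card C" if "orthonormal E" for E
    using independent_span_bound[OF C(1) orthonormal_independent[OF that]] C(2) by auto
  have "orthonormal {}" by (simp add: orthonormal_def)
  moreover have "\<forall>E. orthonormal E \<longrightarrow> card E < Suc (card C)"
    using bound by (simp add: less_Suc_eq_le)
  ultimately obtain E where E: "orthonormal E"
    and max: "\<And>F. orthonormal F \<Longrightarrow> card F \<le> card E"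
    using ex_has_greatest_nat[of orthonormal "{}" card] by metis
  have fin: "finite E" using bound[OF E] by simp
  have "span E = UNIV"
  proof (rule ccontr)
    assume "span E \<noteq> UNIV"
    then obtain v where v: "v \<notin> span E" by auto
    define s where "s = (\<Sum>e\<in>E. scale (ip v e) e)"
    define w where "w = v - s"
    have "s \<in> span E"
      unfolding s_def by (intro span_sum span_scale span_base)
    with v have wE: "w \<notin> span E"
      using span_add[of w E s] by (auto simp: w_def)
    then have "w \<noteq> 0" using span_zero by blast
    have orth: "ip w e = 0" if "e \<in> E" for e
      using orthonormal_ip_sum[OF E fin order_refl that, of "ip v"] that
      by (simp add: w_def s_def ip_diff)
    then have orth': "ip e w = 0" if "e \<in> E" for e
      using that ip_commute[of e w] by simp
    define N where "N = Re (ip w w)"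
    have ww: "ip w w = of_real N"
      using ip_commute[of w w] by (simp add: N_def complex_eq_iff)
    have N: "N > 0"
      using \<open>w \<noteq> 0\<close> ip_eq_zero[of w] ww ip_nonneg[of w]
      unfolding N_def[symmetric] by (cases "N = 0") auto
    define u where "u = scale (of_real (1 / sqrt N)) w"
    have "1 / sqrt N * (1 / sqrt N * N) = 1"
      using N by simp
    then have "complex_of_real (1 / sqrt N) * (complex_of_real (1 / sqrt N) * of_real N) = 1"
      by (metis of_real_mult of_real_1)
    then have uu: "ip u u = 1"
      by (simp only: u_def ip_scale ip_scale_right ww complex_cnj_complex_of_real)
    have "complex_of_real (sqrt N) * of_real (1 / sqrt N) = 1"
      using N by simp
    then have "w = scale (of_real (sqrt N)) u"
      by (simp only: u_def scale_scale scale_one)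
    with wE have "u \<notin> E"
      using span_scale[OF span_base, of u E] by auto
    have "ip u e = 0 \<and> ip e u = 0" if "e \<in> E" for e
      using orth[OF that] orth'[OF that] by (simp add: u_def ip_scale ip_scale_right)
    with E uu \<open>u \<notin> E\<close> have "orthonormal (insert u E)"
      unfolding orthonormal_def by auto
    from max[OF this] show False
      using fin \<open>u \<notin> E\<close> by simp
  qed
  with E orthonormal_independent[OF E] that show thesis by blast
qed

lemma op_trace_orthonormal:
  assumes a: "a \<in> operators" and E: "orthonormal E" "span E = UNIV"
  shows "op_trace a = (\<Sum>e\<in>E. ip (a e) e)"
proof -
  have ind: "independent E" using E(1) by (rule orthonormal_independent)
  have fin: "finite E" using finite_basis[OF ind E(2)] .
  have "representation E (a e) e = ip (a e) e" if "e \<in> E" for e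
    using orthonormal_ip_sum[OF E(1) fin order_refl that, of "representation E (a e)"] that
      sum_representation_eq[of E "a e" E] ind E(2) fin by simp
  then show ?thesis
    using op_trace_eq[OF a ind E(2)] by (simp add: trace_wrt_def)
qed

text \<open>In an orthonormal basis the trace is a sum of nonnegative values of the form of \<open>b\<close>, so all of
  them vanish and \<open>b\<close> kills the basis.\<close>
lemma effect_trace_faithful:
  assumes b: "effect b" and "Re (op_trace b) = 0"
  shows "b x = 0"
proof -
  have op: "b \<in> operators" using b effect_def by blast
  obtain E where E: "orthonormal E" "independent E" "span E = UNIV"
    by (rule orthonormal_basis_exists)
  have fin: "finite E" using finite_basis E by blast
  have "(\<Sum>e\<in>E. Re (ip (b e) e)) = 0"
    using assms(2) op_trace_orthonormal[OF op E(1,3)] by simp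
  then have "\<forall>e\<in>E. Re (ip (b e) e) = 0"
    using b fin by (subst (asm) sum_nonneg_eq_0_iff) (auto simp: effect_iff)
  then have zero: "b e = 0" if "e \<in> E" for e
    using that effect_form_zero[OF b] by blast
  have lin: "Vector_Spaces.linear scale scale b" using op by (simp add: operators_def)
  interpret b: Vector_Spaces.linear scale scale b by (rule lin)
  show ?thesis
    using b.eq_0_on_span[of E x] zero E(3) by simp
qed

section \<open>The trace of an idempotent\<close>

text \<open>Extend a basis \<open>R\<close> of the range to a basis of the whole space. Each vector of \<open>R\<close> is fixed and
  contributes \<open>1\<close>; any other basis vector is sent into the span of \<open>R\<close> and contributes \<open>0\<close>.\<close>
lemma op_trace_idempotent:
  assumes a: "a \<in> operators" and idem: "\<And>x. a (a x) = a x"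
  shows "\<exists>k\<le>dim UNIV. op_trace a = of_nat k"
proof -
  obtain R where R: "R \<subseteq> range a" "independent R" "range a \<subseteq> span R"
    using maximal_independent_subset by metis
  define B where "B = extend_basis R"
  have B: "independent B" "span B = UNIV" "R \<subseteq> B"
    using R(2) by (simp_all add: B_def independent_extend_basis span_extend_basis extend_basis_superset)
  have fin: "finite B" using finite_basis B by blast
  have "representation B (a b) b = (if b \<in> R then 1 else 0)" if b: "b \<in> B" for b
  proof (cases "b \<in> R")
    case True
    then have "a b = b" using R(1) idem by auto
    then show ?thesis using True b representation_basis[OF B(1) b] by simp
  next
    case False
    have ab: "a b \<in> span R" using R(3) by blast
    have "representation B (a b) = representation R (a b)"
      using representation_extend[OF B(1) ab B(3)] .
    then show ?thesis using False representation_ne_zero[of R "a b" b] by auto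
  qed
  then have "op_trace a = (\<Sum>b\<in>B. if b \<in> R then 1 else 0)"
    using op_trace_eq[OF a B(1,2)] by (simp add: trace_wrt_def)
  also have "\<dots> = of_nat (card R)"
    using fin B(3) by (simp add: sum.If_cases Int_absorb1)
  finally have "op_trace a = of_nat (card R)" .
  moreover have "card R \<le> dim UNIV"
    using card_mono[OF fin B(3)] B(1,2) by (metis dim_eq_card span_UNIV)
  ultimately show ?thesis by blast
qed

section \<open>Extreme points of the spectral scale\<close>

lemma op_trace_add:
  assumes "a \<in> operators" "b \<in> operators"
  shows "op_trace (\<lambda>x. a x + b x) = op_trace a + op_trace b"
  unfolding op_trace_def trace_wrt_def
  using extend_basis_empty by (simp add: representation_add sum.distrib)

lemma Psi_add:
  assumes "c \<in> operators" "a \<in> operators" "b \<in> operators"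
  shows "Psi c (\<lambda>x. a x + b x) = Psi c a + Psi c b"
proof -
  have comp: "c \<circ> f \<in> operators" if "f \<in> operators" for f
    using assms(1) that by (intro operatorsI) (auto simp: operators_add operators_scale)
  have "c \<circ> (\<lambda>x. a x + b x) = (\<lambda>x. (c \<circ> a) x + (c \<circ> b) x)"
    using assms(1) by (auto simp: operators_add)
  then show ?thesis
    using op_trace_add[OF assms(2,3)] op_trace_add[OF comp[OF assms(2)] comp[OF assms(3)]]
    by (simp add: Psi_def normalized_trace_def add_divide_distrib)
qed

lemma spectral_scale_eq: "spectral_scale c = {Psi c a |a. effect a}"
  by (simp add: spectral_scale_def effect_def)

text \<open>The square \<open>a\<^sup>2\<close> and its reflection \<open>2a - a\<^sup>2\<close> in \<open>a\<close> have midpoint \<open>a\<close>, so extremality forces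
  \<open>\<Psi>(a - a\<^sup>2) = 0\<close>; faithfulness of the trace applies to the first coordinate.\<close>
lemma effect_idempotent_if_extreme:
  assumes c: "c \<in> operators" and a: "effect a"
    and ext: "Psi c a extreme_point_of spectral_scale c"
    and dim: "dim UNIV > 0"
  shows "a (a x) = a x"
proof -
  let ?q = "\<lambda>x. a (a x)" and ?b = "\<lambda>x. a x - a (a x)" and ?r = "\<lambda>x. a x + (a x - a (a x))"
  have q: "effect ?q" and b: "effect ?b" and r: "effect ?r"
    using a effect_square effect_diff_square effect_reflected_square by auto
  have ops: "a \<in> operators" "?q \<in> operators" "?b \<in> operators"
    using a q b effect_def by auto
  have Pr: "Psi c ?r = Psi c a + Psi c ?b"
    using Psi_add[OF c ops(1,3)] .
  have Pa: "Psi c a = Psi c ?q + Psi c ?b"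
    using Psi_add[OF c ops(2,3)] by simp
  have "Psi c a = midpoint (Psi c ?q) (Psi c ?r)"
    unfolding Pr Pa midpoint_def by (simp add: prod_eq_iff complex_eq_iff)
  moreover have "Psi c ?q \<in> spectral_scale c" "Psi c ?r \<in> spectral_scale c"
    using q r by (auto simp: spectral_scale_eq)
  ultimately have "Psi c ?q = Psi c ?r"
    using ext unfolding extreme_point_of_def by (metis midpoint_in_open_segment)
  with Pr Pa have "Psi c ?b = 0"
    by (simp add: prod_eq_iff complex_eq_iff)
  then have "Re (op_trace ?b / of_nat (dim UNIV)) = 0"
    by (simp add: Psi_def normalized_trace_def prod_eq_iff)
  then have "Re (op_trace ?b) = 0"
    using dim by (simp add: Re_divide_of_nat)
  from effect_trace_faithful[OF b this, of x] show ?thesis by simp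
qed

lemma extreme_point_in_isotrace_slice:
  assumes c: "c \<in> operators" and ext: "x extreme_point_of spectral_scale c"
    and dim: "dim UNIV > 0"
  shows "\<exists>k\<in>{0..dim UNIV}. x \<in> isotrace_slice c (real k / real (dim UNIV))"
proof -
  have xB: "x \<in> spectral_scale c" using ext by (simp add: extreme_point_of_def)
  then obtain a where a: "effect a" and x: "x = Psi c a"
    by (auto simp: spectral_scale_eq)
  have op: "a \<in> operators" using a effect_def by blast
  have "a (a y) = a y" for y
    using effect_idempotent_if_extreme[OF c a] ext dim x by blast
  then obtain k where k: "k \<le> dim UNIV" "op_trace a = of_nat k"
    using op_trace_idempotent[OF op] by blast
  have "fst x = real k / real (dim UNIV)"
    using k(2) by (simp add: x Psi_def normalized_trace_def Re_divide_of_nat)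
  then have "x \<in> isotrace_slice c (real k / real (dim UNIV))"
    using xB by (cases x) (simp add: isotrace_slice_def)
  with k(1) show ?thesis by auto
qed

end

theorem theorem1p1:
  fixes scale :: "complex \<Rightarrow> 'h::ab_group_add \<Rightarrow> 'h"
    and ip :: "'h \<Rightarrow> 'h \<Rightarrow> complex"
    and c :: "'h \<Rightarrow> 'h" and n :: nat and x :: "real \<times> complex"
  assumes "finite_dim_hilbert scale ip"
    and "vector_space.dim scale (UNIV :: 'h set) = n" and "n \<ge> 1"
    and "c \<in> finite_dim_hilbert.operators scale"
    and "x extreme_point_of (finite_dim_hilbert.spectral_scale scale ip c)"
  shows "\<exists>k\<in>{0..n}. x \<in> finite_dim_hilbert.isotrace_slice scale ip c (real k / real n)"
  using finite_dim_hilbert.extreme_point_in_isotrace_slice[OF assms(1,4,5)] assms(2,3) by simp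

end
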